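(* Let $k$ be a field and $n\ge 3$. Let $I\subset k[x,y]$ be an ideal minimally generated by $n$ monomials listed lexicographically, $$I=(x^{a_1},\, x^{a_2}y^{b_{n-1}},\ldots,x^{a_i}y^{b_{n-i+1}},\ldots, x^{a_{n-1}}y^{b_2},\, y^{b_1}),$$ where $a_1>a_2>\cdots>a_{n-1}>a_n:=0$ and $b_1>b_2>\cdots>b_{n-1}>b_n:=0$ are integers. Let $1\le i\le n-2$, so that $P_i=(a_i,b_{n-i+1})$, $P_{i+1}=(a_{i+1},b_{n-i})$, $P_{i+2}=(a_{i+2},b_{n-i-1})$ are three consecutive points corresponding to the exponents of the defining monomials of $I$. The following hold: (a) If $I=\overline{I}$ and $b_{n-i-1}-b_{n-i}=1$, $b_{n-i}-b_{n-i+1}=1$, then $a_{i+1}\le \left\lceil\frac{a_i+a_{i+2}}{2}\right\rceil$. (b) If $I=\overline{I}$ and $a_i-a_{i+1}=1$, $a_{i+1}-a_{i+2}=1$, then $b_{n-i}\le\left\lceil\frac{b_{n-i-1}+b_{n-i+1}}{2}\right\rceil$.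
   Context: $\overline I$ denotes the integral closure of the ideal $I$, and $\lceil r\rceil$ the ceiling of a real number $r$. *)

theory Defs
  imports Complex_Main "HOL-Computational_Algebra.Polynomial"
begin

text \<open>
  Ideals of a commutative ring are its submodules as a module over itself, so the ideal
  generated by a set is the span with respect to ring multiplication.
\<close>

lemma module_times: "module ((*) :: 'r::comm_ring_1 \<Rightarrow> 'r \<Rightarrow> 'r)"
  by unfold_locales (simp_all add: algebra_simps)

definition ideal_gen :: "'r::comm_ring_1 set \<Rightarrow> 'r set" where
  "ideal_gen S = module.span (*) S"

definition minimally_generates :: "'r::comm_ring_1 set \<Rightarrow> 'r set \<Rightarrow> bool" where
  "minimally_generates S I \<longleftrightarrow> ideal_gen S = I \<and> (\<forall>T. T \<subset> S \<longrightarrow> ideal_gen T \<noteq> I)"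

primrec ideal_power :: "'r::comm_ring_1 set \<Rightarrow> nat \<Rightarrow> 'r set" where
  "ideal_power I 0 = UNIV"
| "ideal_power I (Suc m) = ideal_gen {f * g | f g. f \<in> I \<and> g \<in> ideal_power I m}"

text \<open>
  The integral closure of \<open>I\<close>: all \<open>r\<close> satisfying an equation
  \<open>r ^ m + c 1 * r ^ (m - 1) + \<dots> + c m = 0\<close> with \<open>m \<ge> 1\<close> and each \<open>c j\<close> in the
  \<open>j\<close>-th power of \<open>I\<close>.
\<close>

definition integral_closure :: "'r::comm_ring_1 set \<Rightarrow> 'r set" where
  "integral_closure I =
    {r. \<exists>m\<ge>1. \<exists>c. (\<forall>j\<in>{1..m}. c j \<in> ideal_power I j) \<and>
          r ^ m + (\<Sum>j=1..m. c j * r ^ (m - j)) = 0}"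

text \<open>
  The ring \<open>k[x,y]\<close> is rendered as \<open>k[x][y]\<close>: the inner polynomial variable is \<open>x\<close>,
  the outer one is \<open>y\<close>.
\<close>

definition var_x :: "'k::field poly poly" where
  "var_x = [:[:0, 1:]:]"

definition var_y :: "'k::field poly poly" where
  "var_y = [:0, 1:]"

end

theory Submission
  imports Defs
begin

text \<open>
  The midpoint of two points whose monomials lie in \<open>I\<close> yields an element integral over
  \<open>I\<close>: if \<open>p\<close> and \<open>q\<close> are at least the averages of the \<open>x\<close>- and of the \<open>y\<close>-exponents of
  \<open>P_i\<close> and \<open>P_{i+2}\<close>, then the square of \<open>r = x ^ p * y ^ q\<close> is a multiple of the product
  of these two generators, so that \<open>r ^ 2\<close> lies in \<open>I ^ 2\<close> and the equation
  \<open>r ^ 2 - r ^ 2 = 0\<close> shows that \<open>r\<close> is integral over \<open>I\<close>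
  (lemma \<open>integral_closure_memI_square\<close>).
  If \<open>I\<close> is integrally closed, \<open>r\<close> thus lies in \<open>I\<close>; as \<open>I\<close> is a monomial ideal, some
  generator \<open>x ^ a j * y ^ b (n - j + 1)\<close> must divide \<open>r\<close>
  (lemma \<open>monomial_in_ideal_gen_imp_dvd\<close>).

  For (a), \<open>q = b (n - i)\<close> is exactly the average of its two neighbours; take for \<open>p\<close> the
  rounded-up average of \<open>a i\<close> and \<open>a (i + 2)\<close>. The dividing generator has
  \<open>b (n - j + 1) \<le> b (n - i)\<close>, so by monotonicity it is \<open>P_{i+1}\<close> or a point to its right,
  whence \<open>a (i + 1) \<le> a j \<le> p\<close>. Part (b) is the same with the two coordinates exchanged.
\<close>

lemma var_powers_eq_monom: "var_x ^ s * var_y ^ t = monom (monom 1 s) t"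
proof -
  have "var_x ^ s = ([:monom 1 s:] :: 'a poly poly)"
    by (induction s) (simp_all add: var_x_def monom_0 monom_Suc one_pCons)
  moreover have "var_y ^ t = (monom 1 t :: 'a poly poly)"
    by (induction t) (simp_all add: var_y_def monom_0 monom_Suc)
  ultimately show ?thesis
    by (simp add: smult_monom)
qed

lemma ideal_gen_base: "f \<in> S \<Longrightarrow> f \<in> ideal_gen S"
  unfolding ideal_gen_def by (rule module.span_base[OF module_times])

lemma ideal_gen_mult: "f \<in> ideal_gen S \<Longrightarrow> u * f \<in> ideal_gen S"
  unfolding ideal_gen_def by (rule module.span_scale[OF module_times])

text \<open>
  The polynomials all of whose exponents lie above a point of \<open>E\<close> form an ideal: each
  monomial of a product \<open>u * f\<close> is a multiple of some monomial of \<open>f\<close>. That ideal contains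
  the generators, hence everything they generate.
\<close>

lemma exponent_above_generator:
  fixes f :: "'k::field poly poly"
  assumes "f \<in> ideal_gen {var_x ^ s * var_y ^ t | s t. (s, t) \<in> E}"
    and "coeff (coeff f q) p \<noteq> 0"
  shows "\<exists>(s, t)\<in>E. s \<le> p \<and> t \<le> q"
proof -
  define J :: "'k poly poly set" where
    "J = {f. \<forall>p q. coeff (coeff f q) p \<noteq> 0 \<longrightarrow> (\<exists>(s, t)\<in>E. s \<le> p \<and> t \<le> q)}"
  have "module.subspace (*) J"
    unfolding module.subspace_def[OF module_times]
  proof (intro conjI ballI allI)
    show "0 \<in> J"
      by (simp add: J_def)
  next
    fix f g assume "f \<in> J" "g \<in> J"
    then show "f + g \<in> J"
      unfolding J_def by (simp del: split_paired_Ex) (metis add.right_neutral)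
  next
    fix u f assume f: "f \<in> J"
    show "u * f \<in> J"
      unfolding J_def
    proof (intro CollectI allI impI)
      fix p q assume "coeff (coeff (u * f) q) p \<noteq> 0"
      then have "(\<Sum>k\<le>q. \<Sum>l\<le>p. coeff (coeff u k) l * coeff (coeff f (q - k)) (p - l)) \<noteq> 0"
        by (simp add: coeff_mult coeff_sum)
      then obtain k l where "coeff (coeff f (q - k)) (p - l) \<noteq> 0"
        by (metis (no_types, lifting) mult_zero_right sum.neutral)
      with f have "\<exists>(s, t)\<in>E. s \<le> p - l \<and> t \<le> q - k"
        by (simp add: J_def)
      then show "\<exists>(s, t)\<in>E. s \<le> p \<and> t \<le> q"
        by (auto intro: le_trans[OF _ diff_le_self])
    qed
  qed
  moreover have "{var_x ^ s * var_y ^ t | s t. (s, t) \<in> E} \<subseteq> J"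
    by (auto simp: J_def var_powers_eq_monom coeff_monom split: if_splits)
  ultimately have "ideal_gen {var_x ^ s * var_y ^ t | s t. (s, t) \<in> E} \<subseteq> J"
    unfolding ideal_gen_def using module.span_minimal[OF module_times] by blast
  with assms show ?thesis
    by (auto simp: J_def)
qed

lemma monomial_in_ideal_gen_imp_dvd:
  assumes "(var_x ^ p * var_y ^ q :: 'k::field poly poly)
             \<in> ideal_gen {var_x ^ s * var_y ^ t | s t. (s, t) \<in> E}"
  shows "\<exists>(s, t)\<in>E. s \<le> p \<and> t \<le> q"
  by (rule exponent_above_generator[OF assms]) (simp add: var_powers_eq_monom)

text \<open>
  The polynomial \<open>T ^ 2 - r ^ 2\<close> has the root \<open>r\<close>, and it is an equation of integral
  dependence over \<open>I\<close>: its linear coefficient vanishes, and its constant one lies in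
  \<open>I ^ 2\<close>.
\<close>

lemma integral_closure_memI_square:
  fixes r :: "'r::comm_ring_1"
  assumes "f \<in> I" "g \<in> I" and r: "r ^ 2 = u * (f * g)"
  shows "r \<in> integral_closure I"
proof -
  have "g \<in> ideal_power I 1"
    using \<open>g \<in> I\<close> by (auto intro!: ideal_gen_base) (metis mult.right_neutral)
  then have "f * g \<in> ideal_power I 2"
    using \<open>f \<in> I\<close> by (auto simp: numeral_2_eq_2 intro!: ideal_gen_base)
  then have "(- u) * (f * g) \<in> ideal_power I 2"
    by (simp add: numeral_2_eq_2 ideal_gen_mult del: mult_minus_left)
  then have c2: "- (r ^ 2) \<in> ideal_power I 2"
    by (simp add: r)
  have c1: "0 \<in> ideal_power I 1"
    using ideal_gen_mult[of g _ 0] \<open>g \<in> ideal_power I 1\<close> by simp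
  define c where "c = (\<lambda>j::nat. if j = 2 then - (r ^ 2) else 0)"
  have "c j \<in> ideal_power I j" if "j \<in> {1..2}" for j
  proof -
    from that have "j = 1 \<or> j = 2"
      by auto
    with c1 c2 show ?thesis
      by (auto simp: c_def)
  qed
  moreover have "r ^ 2 + (\<Sum>j=1..2. c j * r ^ (2 - j)) = 0"
    by (simp add: c_def numeral_2_eq_2)
  ultimately show ?thesis
    unfolding integral_closure_def
    by (intro CollectI exI[of _ "2::nat"] exI[of _ c] conjI) simp_all
qed

lemma midpoint_in_integral_closure:
  fixes I :: "'k::field poly poly set"
  assumes "var_x ^ s * var_y ^ t \<in> I" "var_x ^ s' * var_y ^ t' \<in> I"
    and "s + s' \<le> 2 * p" "t + t' \<le> 2 * q"
  shows "var_x ^ p * var_y ^ q \<in> integral_closure I"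
proof (rule integral_closure_memI_square[OF assms(1,2)])
  show "(var_x ^ p * var_y ^ q) ^ 2 =
      (var_x ^ (2 * p - (s + s')) * var_y ^ (2 * q - (t + t'))) *
      (var_x ^ s * var_y ^ t * (var_x ^ s' * var_y ^ t') :: 'k poly poly)"
    using assms(3,4)
    by (simp add: var_powers_eq_monom mult_monom power2_eq_square flip: mult_2)
qed

lemma decreasing_imp_antimono:
  fixes a :: "nat \<Rightarrow> nat"
  assumes "\<forall>j\<in>{1..<n}. a j > a (j + 1)" "1 \<le> j" "j \<le> l" "l \<le> n"
  shows "a l \<le> a j"
  using assms(3,4)
proof (induction l rule: dec_induct)
  case (step l)
  with assms(1)[rule_format, of l] \<open>1 \<le> j\<close> show ?case
    by auto
qed simp

lemma le_twice_ceiling_half: "s + t \<le> 2 * nat \<lceil>(real s + real t) / 2\<rceil>"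
proof -
  have "s + t \<le> 2 * m" if "(real s + real t) / 2 \<le> real m" for m
  proof -
    have "real (s + t) \<le> real (2 * m)"
      using that by simp
    then show ?thesis
      by (simp only: of_nat_le_iff)
  qed
  from this[OF real_nat_ceiling_ge] show ?thesis .
qed

lemma ceiling_half_nonneg: "0 \<le> \<lceil>(real s + real t) / 2\<rceil>"
proof -
  have "0 \<le> (real s + real t) / 2"
    by simp
  then show ?thesis
    by linarith
qed

theorem proposition2p12:
  fixes I :: "'k::field poly poly set"
    and n i :: nat
    and a b :: "nat \<Rightarrow> nat"
  assumes n: "n \<ge> 3"
    and a_decreasing: "\<forall>j\<in>{1..<n}. a j > a (j + 1)"
    and a_last: "a n = 0"
    and b_decreasing: "\<forall>j\<in>{1..<n}. b j > b (j + 1)"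
    and b_last: "b n = 0"
    and I: "minimally_generates {var_x ^ a j * var_y ^ b (n - j + 1) | j. j \<in> {1..n}} I"
    and i: "1 \<le> i" "i \<le> n - 2"
  shows "(I = integral_closure I \<and>
           int (b (n - i - 1)) - int (b (n - i)) = 1 \<and>
           int (b (n - i)) - int (b (n - i + 1)) = 1 \<longrightarrow>
           int (a (i + 1)) \<le> \<lceil>(real (a i) + real (a (i + 2))) / 2\<rceil>) \<and>
         (I = integral_closure I \<and>
           int (a i) - int (a (i + 1)) = 1 \<and>
           int (a (i + 1)) - int (a (i + 2)) = 1 \<longrightarrow>
           int (b (n - i)) \<le> \<lceil>(real (b (n - i - 1)) + real (b (n - i + 1))) / 2\<rceil>)"
proof -
  define E where "E = {(a j, b (n - j + 1)) | j. j \<in> {1..n}}"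
  have gens: "{var_x ^ a j * var_y ^ b (n - j + 1) | j. j \<in> {1..n}} =
      {var_x ^ s * var_y ^ t | s t. (s, t) \<in> E}"
    by (auto simp: E_def)
  have I_eq: "I = ideal_gen {var_x ^ s * var_y ^ t | s t. (s, t) \<in> E}"
    using I unfolding minimally_generates_def gens by simp
  have P: "var_x ^ a j * var_y ^ b (n - j + 1) \<in> I" if "j \<in> {1..n}" for j
    unfolding I_eq using that by (intro ideal_gen_base) (auto simp: E_def)
  have idx: "n - (i + 2) + 1 = n - i - 1"
    using i n by simp
  have dividing_generator: "\<exists>j\<in>{1..n}. a j \<le> p \<and> b (n - j + 1) \<le> q"
    if "I = integral_closure I" "a i + a (i + 2) \<le> 2 * p"
      "b (n - i + 1) + b (n - i - 1) \<le> 2 * q" for p q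
  proof -
    have "var_x ^ p * var_y ^ q \<in> integral_closure I"
    proof (rule midpoint_in_integral_closure[OF _ _ that(2,3)])
      show "var_x ^ a i * var_y ^ b (n - i + 1) \<in> I"
        using P[of i] i by simp
      show "var_x ^ a (i + 2) * var_y ^ b (n - i - 1) \<in> I"
        using P[of "i + 2"] i n unfolding idx by simp
    qed
    then have "var_x ^ p * var_y ^ q \<in> I"
      using that(1) by simp
    from monomial_in_ideal_gen_imp_dvd[OF this[unfolded I_eq]] show ?thesis
      by (auto simp: E_def)
  qed
  have "int (a (i + 1)) \<le> \<lceil>(real (a i) + real (a (i + 2))) / 2\<rceil>" (is "_ \<le> ?c")
    if closed: "I = integral_closure I"
      and "int (b (n - i - 1)) - int (b (n - i)) = 1" "int (b (n - i)) - int (b (n - i + 1)) = 1"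
  proof -
    have "a i + a (i + 2) \<le> 2 * nat ?c"
      by (rule le_twice_ceiling_half)
    moreover have "b (n - i + 1) + b (n - i - 1) \<le> 2 * b (n - i)"
      using that(2,3) by linarith
    ultimately obtain j where j: "j \<in> {1..n}" "a j \<le> nat ?c" "b (n - j + 1) \<le> b (n - i)"
      using dividing_generator[OF closed] by blast
    have "j \<le> i + 1"
    proof (rule ccontr)
      assume "\<not> j \<le> i + 1"
      then have "b (n - i - 1) \<le> b (n - j + 1)"
        using decreasing_imp_antimono[OF b_decreasing, of "n - j + 1" "n - i - 1"] j(1) by auto
      with j(3) that(2) show False
        by linarith
    qed
    then have "a (i + 1) \<le> a j"
      using decreasing_imp_antimono[OF a_decreasing, of j "i + 1"] j(1) i n by auto
    moreover have "0 \<le> ?c"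
      by (rule ceiling_half_nonneg)
    ultimately show ?thesis
      using j(2)
      by linarith
  qed
  moreover have "int (b (n - i)) \<le> \<lceil>(real (b (n - i - 1)) + real (b (n - i + 1))) / 2\<rceil>"
      (is "_ \<le> ?c")
    if closed: "I = integral_closure I"
      and "int (a i) - int (a (i + 1)) = 1" "int (a (i + 1)) - int (a (i + 2)) = 1"
  proof -
    have "b (n - i + 1) + b (n - i - 1) \<le> 2 * nat ?c"
      using le_twice_ceiling_half[of "b (n - i - 1)" "b (n - i + 1)"] by simp
    moreover have "a i + a (i + 2) \<le> 2 * a (i + 1)"
      using that(2,3) by linarith
    ultimately obtain j where j: "j \<in> {1..n}" "a j \<le> a (i + 1)" "b (n - j + 1) \<le> nat ?c"
      using dividing_generator[OF closed] by blast
    have "i + 1 \<le> j"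
    proof (rule ccontr)
      assume "\<not> i + 1 \<le> j"
      then have "a i \<le> a j"
        using decreasing_imp_antimono[OF a_decreasing, of j i] j(1) i by auto
      with j(2) that(2) show False
        by linarith
    qed
    then have "b (n - i) \<le> b (n - j + 1)"
      using decreasing_imp_antimono[OF b_decreasing, of "n - j + 1" "n - i"] j(1) i n by auto
    moreover have "0 \<le> ?c"
      by (rule ceiling_half_nonneg)
    ultimately show ?thesis
      using j(3)
      by linarith
  qed
  ultimately show ?thesis
    by blast
qed

end
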